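(* For every integer $n\ge 1$, the number $N_{st}(\Gamma_n)$ of spanning trees of the $n$-cube $\Gamma_n$ is $$N_{st}(\Gamma_n) = 2^{2^{n}-n-1}\prod_{k=1}^{n}k^{\binom{n}{k}}.$$
   Context: For $n\ge 1$, let $G_n = \mathbb{Z}_2^n$ and $S_n = \{(x_1,\dots,x_n)\in G_n : \text{exactly one } x_i \text{ equals } 1\}$. The $n$-cube $\Gamma_n = \mathrm{Cay}(G_n,S_n)$ is the simple undirected graph with vertex set $G_n$ in which $g$ and $g'$ are adjacent iff $g' = g+s$ for some $s\in S_n$. A spanning tree of a graph is a subgraph that is a tree and includes all the vertices of the graph; spanning trees are counted as (labelled) subgraphs. *)

theory Defs
  imports "HOL-Algebra.Product_Groups"
begin

section \<open>Simple undirected graphs\<close>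

record 'a ugraph =
  verts :: "'a set"
  edges :: "'a set set"

definition simple_graph :: "'a ugraph \<Rightarrow> bool" where
  "simple_graph G \<longleftrightarrow> (\<forall>e\<in>edges G. e \<subseteq> verts G \<and> card e = 2)"

definition adjacent :: "'a ugraph \<Rightarrow> 'a \<Rightarrow> 'a \<Rightarrow> bool" where
  "adjacent G u v \<longleftrightarrow> {u, v} \<in> edges G"

definition subgraph :: "'a ugraph \<Rightarrow> 'a ugraph \<Rightarrow> bool" where
  "subgraph H G \<longleftrightarrow> simple_graph H \<and> verts H \<subseteq> verts G \<and> edges H \<subseteq> edges G"

definition walk :: "'a ugraph \<Rightarrow> 'a list \<Rightarrow> bool" where
  "walk G xs \<longleftrightarrow> xs \<noteq> [] \<and> set xs \<subseteq> verts G \<and> successively (adjacent G) xs"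

definition connected_graph :: "'a ugraph \<Rightarrow> bool" where
  "connected_graph G \<longleftrightarrow> verts G \<noteq> {} \<and>
     (\<forall>u\<in>verts G. \<forall>v\<in>verts G. \<exists>xs. walk G xs \<and> hd xs = u \<and> last xs = v)"

text \<open>A cycle is the list of its distinct vertices, without repeating the first one at the
  end. The length bound excludes going back and forth along a single edge.\<close>

definition is_cycle :: "'a ugraph \<Rightarrow> 'a list \<Rightarrow> bool" where
  "is_cycle G xs \<longleftrightarrow>
     walk G xs \<and> distinct xs \<and> length xs \<ge> 3 \<and> adjacent G (last xs) (hd xs)"

definition is_tree :: "'a ugraph \<Rightarrow> bool" where
  "is_tree G \<longleftrightarrow> simple_graph G \<and> connected_graph G \<and> (\<nexists>xs. is_cycle G xs)"

definition spanning_tree :: "'a ugraph \<Rightarrow> 'a ugraph \<Rightarrow> bool" where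
  "spanning_tree T G \<longleftrightarrow> subgraph T G \<and> is_tree T \<and> verts T = verts G"

definition num_spanning_trees :: "'a ugraph \<Rightarrow> nat" where
  "num_spanning_trees G = card {T. spanning_tree T G}"

lemma finite_spanning_trees:
  assumes "finite (verts G)"
  shows "finite {T. spanning_tree T G}"
proof (rule finite_subset)
  show "{T. spanning_tree T G} \<subseteq>
    (\<lambda>E. \<lparr>verts = verts G, edges = E\<rparr>) ` Pow (Pow (verts G))"
  proof
    fix T assume "T \<in> {T. spanning_tree T G}"
    then have "verts T = verts G" "edges T \<subseteq> Pow (verts G)"
      by (auto simp: spanning_tree_def subgraph_def simple_graph_def)
    then show "T \<in> (\<lambda>E. \<lparr>verts = verts G, edges = E\<rparr>) ` Pow (Pow (verts G))"
      by (intro image_eqI[of _ _ "edges T"]) auto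
  qed
qed (use assms in simp)


section \<open>The \<open>n\<close>-cube as a Cayley graph\<close>

text \<open>This is a simple undirected graph when \<open>S\<close> is closed under inverses and
  does not contain the identity; see \<open>simple_graph_cube\<close> for the case used here.\<close>

definition cayley_graph :: "('a, 'b) monoid_scheme \<Rightarrow> 'a set \<Rightarrow> 'a ugraph" where
  "cayley_graph G S =
     \<lparr>verts = carrier G,
      edges = {{g, g'} | g g'. g \<in> carrier G \<and> g' \<in> carrier G \<and> (\<exists>s\<in>S. g' = g \<otimes>\<^bsub>G\<^esub> s)}\<rparr>"

definition cube_group :: "nat \<Rightarrow> (nat \<Rightarrow> int) monoid" where
  "cube_group n = product_group {1..n} (\<lambda>_. integer_mod_group 2)"

definition cube_generators :: "nat \<Rightarrow> (nat \<Rightarrow> int) set" where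
  "cube_generators n = {x \<in> carrier (cube_group n). \<exists>!i. i \<in> {1..n} \<and> x i = 1}"

definition cube :: "nat \<Rightarrow> (nat \<Rightarrow> int) ugraph" where
  "cube n = cayley_graph (cube_group n) (cube_generators n)"

lemma adjacent_cube_iff:
  assumes "g \<in> carrier (cube_group n)" "g' \<in> carrier (cube_group n)"
  shows "adjacent (cube n) g g' \<longleftrightarrow> (\<exists>s\<in>cube_generators n. g' = g \<otimes>\<^bsub>cube_group n\<^esub> s)"
proof -
  have swap: "g = h \<otimes>\<^bsub>cube_group n\<^esub> s"
    if gc: "g \<in> carrier (cube_group n)" and "s \<in> cube_generators n" and h: "h = g \<otimes>\<^bsub>cube_group n\<^esub> s"
    for g h s
  proof -
    have g: "g \<in> (\<Pi>\<^sub>E i\<in>{1..n}. {0..<2})"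
      using gc by (simp add: cube_group_def carrier_integer_mod_group)
    have "g i = ((g i + s i) mod 2 + s i) mod 2" if "i \<in> {1..n}" for i
    proof -
      have "g i \<in> {0..<2}" using g that by (rule PiE_mem)
      then show ?thesis by simp presburger
    qed
    then have "g i = (h \<otimes>\<^bsub>cube_group n\<^esub> s) i" for i
      using PiE_arb[OF g, of i] unfolding h cube_group_def
      by (cases "i \<in> {1..n}") (simp_all only: mult_product_group mult_integer_mod_group
          restrict_apply if_True if_False of_nat_numeral simp_thms)
    then show ?thesis by (rule ext)
  qed
  show ?thesis
  proof
    assume "adjacent (cube n) g g'"
    then obtain h h' s where "{g, g'} = {h, h'}" and h: "h \<in> carrier (cube_group n)"
      and s: "s \<in> cube_generators n" and h': "h' = h \<otimes>\<^bsub>cube_group n\<^esub> s"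
      unfolding adjacent_def cube_def cayley_graph_def by auto
    then consider "g = h" "g' = h'" | "g = h'" "g' = h"
      unfolding doubleton_eq_iff by blast
    then show "\<exists>s\<in>cube_generators n. g' = g \<otimes>\<^bsub>cube_group n\<^esub> s"
      using swap[OF h s h'] s h' by cases blast+
  next
    assume "\<exists>s\<in>cube_generators n. g' = g \<otimes>\<^bsub>cube_group n\<^esub> s"
    with assms show "adjacent (cube n) g g'"
      unfolding adjacent_def cube_def cayley_graph_def by auto
  qed
qed

lemma simple_graph_cube: "simple_graph (cube n)"
proof -
  have "g \<noteq> g \<otimes>\<^bsub>cube_group n\<^esub> s"
    if "g \<in> carrier (cube_group n)" and s: "s \<in> cube_generators n" for g s
  proof
    assume eq: "g = g \<otimes>\<^bsub>cube_group n\<^esub> s"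
    obtain i where i: "i \<in> {1..n}" "s i = 1"
      using s unfolding cube_generators_def by blast
    have "g i = (g i + 1) mod 2"
      using fun_cong[OF eq, of i] i by (simp add: cube_group_def)
    then show False by presburger
  qed
  then have "card {g, g \<otimes>\<^bsub>cube_group n\<^esub> s} = 2"
    if "g \<in> carrier (cube_group n)" "s \<in> cube_generators n" for g s
    using that by (metis card_2_iff)
  then show ?thesis
    by (auto simp: simple_graph_def cube_def cayley_graph_def)
qed

lemma finite_verts_cube: "finite (verts (cube n))"
  by (simp add: cube_def cayley_graph_def cube_group_def carrier_integer_mod_group finite_PiE)

end

theory Submission
  imports Defs "Jordan_Normal_Form.Determinant"
begin

text \<open>
  Let \<open>L\<close> be the Laplacian of a graph on the vertex set \<open>V\<close>. Expanding the determinant of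
  \<open>t I + L\<close> along its rows gives a sum over all maps \<open>f\<close> that send a vertex either to itself
  (with weight \<open>t\<close>) or to a neighbour; the determinant belonging to \<open>f\<close> is 1 if every vertex
  reaches a fixed point under iteration of \<open>f\<close> and 0 otherwise. The coefficient of \<open>t\<close> therefore
  counts the parent maps of rooted spanning trees, that is, \<open>card V\<close> times the spanning trees.
  For the cube, \<open>L\<close> is diagonalised by the characters of the group, with eigenvalue \<open>2 |s|\<close>
  for \<open>s\<close>, so that the coefficient of \<open>t\<close> is the product of all \<open>2 |s|\<close> with \<open>s \<noteq> 0\<close>.
\<close>

section \<open>Spanning trees and parent maps\<close>

text \<open>The fixed points of \<open>f\<close> are the roots of a forest, and every other vertex is mapped to its
  parent.\<close>

definition rooted :: "'a set \<Rightarrow> ('a \<Rightarrow> 'a) \<Rightarrow> bool" where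
  "rooted V f \<longleftrightarrow> (\<forall>v\<in>V. \<exists>k. f ((f ^^ k) v) = (f ^^ k) v)"

section \<open>Walks and cycles in simple graphs\<close>

lemma adjacent_sym: "adjacent G u v \<longleftrightarrow> adjacent G v u"
  by (simp add: adjacent_def insert_commute)

lemma adjacent_verts:
  assumes "simple_graph G" "adjacent G u v"
  shows "u \<in> verts G" "v \<in> verts G" "u \<noteq> v"
  using assms by (auto simp: simple_graph_def adjacent_def card_2_iff doubleton_eq_iff)

lemma walk_imp_rtranclp:
  assumes "walk G xs"
  shows "(adjacent G)\<^sup>*\<^sup>* (hd xs) (last xs)"
  using assms
proof (induction xs rule: induct_list012)
  case (3 x y zs)
  then have "(adjacent G)\<^sup>*\<^sup>* y (last (y # zs))" and "adjacent G x y"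
    by (auto simp: walk_def)
  then show ?case
    by (simp add: converse_rtranclp_into_rtranclp)
qed (auto simp: walk_def)

lemma rtranclp_imp_walk:
  assumes "simple_graph G" "u \<in> verts G" "(adjacent G)\<^sup>*\<^sup>* u v"
  shows "\<exists>xs. walk G xs \<and> hd xs = u \<and> last xs = v"
  using assms(3,2)
proof (induction rule: converse_rtranclp_induct)
  case base
  then show ?case by (intro exI[of _ "[v]"]) (simp add: walk_def)
next
  case (step x y)
  obtain xs where "walk G xs" "hd xs = y" "last xs = v"
    using step adjacent_verts[OF assms(1)] by blast
  then show ?case
    using step by (intro exI[of _ "x # xs"]) (auto simp: walk_def successively_Cons)
qed

lemma walk_remove_loop:
  assumes "walk G (as @ [y] @ bs @ [y] @ cs)"
  shows "walk G (as @ [y] @ cs)"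
  using assms by (auto simp: walk_def successively_append_iff successively_Cons)

text \<open>A shortest walk repeats no vertex, since the stretch between two occurrences could be
  cut out.\<close>

lemma rtranclp_imp_distinct_walk:
  assumes "simple_graph G" "u \<in> verts G" "(adjacent G)\<^sup>*\<^sup>* u v"
  shows "\<exists>xs. walk G xs \<and> distinct xs \<and> hd xs = u \<and> last xs = v"
proof -
  let ?P = "\<lambda>xs. walk G xs \<and> hd xs = u \<and> last xs = v"
  obtain xs where xs: "?P xs" and min: "\<And>ys. ?P ys \<Longrightarrow> length xs \<le> length ys"
    using rtranclp_imp_walk[OF assms] ex_has_least_nat[of ?P _ length] by blast
  have "distinct xs"
  proof (rule ccontr)
    assume "\<not> distinct xs"
    then obtain as bs cs y where eq: "xs = as @ [y] @ bs @ [y] @ cs"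
      using not_distinct_decomp by blast
    have "?P (as @ [y] @ cs)"
      using xs walk_remove_loop[of G as y bs cs] unfolding eq by (cases as; cases cs) auto
    from min[OF this] show False by (simp add: eq)
  qed
  with xs show ?thesis by blast
qed

lemma cycle_adjacent:
  assumes "is_cycle G xs" "i < length xs"
  shows "adjacent G (xs ! i) (xs ! (Suc i mod length xs))"
proof (cases "Suc i < length xs")
  case True
  then show ?thesis
    using assms by (auto simp: is_cycle_def walk_def successively_conv_nth)
next
  case False
  then have "Suc i = length xs" using assms(2) by simp
  moreover from this have "i = length xs - 1" by simp
  moreover have "xs \<noteq> []" using assms(2) by auto
  ultimately show ?thesis
    using assms(1) by (simp add: is_cycle_def last_conv_nth hd_conv_nth)
qed

lemma cycle_two_neighbours:
  assumes xs: "is_cycle G xs" and "x \<in> set xs"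
  obtains y z where "y \<in> set xs" "z \<in> set xs" "y \<noteq> z" "adjacent G x y" "adjacent G x z"
proof -
  let ?l = "length xs"
  obtain i where i: "i < ?l" "xs ! i = x"
    using \<open>x \<in> set xs\<close> by (auto simp: in_set_conv_nth)
  have l: "?l \<ge> 3" and dist: "distinct xs"
    using xs by (auto simp: is_cycle_def)
  \<comment> \<open>\<open>j\<close> is the cyclic predecessor of \<open>i\<close>; as the length is
    at least 3, it differs from the cyclic successor.\<close>
  define j where "j = (if i = 0 then ?l - 1 else i - 1)"
  have j: "j < ?l" "Suc j mod ?l = i"
    using i l by (auto simp: j_def)
  have k: "Suc i mod ?l < ?l"
    using l by (intro mod_less_divisor) linarith
  have "Suc i mod ?l \<noteq> j"
    using i l by (cases "Suc i = ?l") (auto simp: j_def)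
  then have "xs ! (Suc i mod ?l) \<noteq> xs ! j"
    using dist j k by (simp add: nth_eq_iff_index_eq)
  then show thesis
    using that[of "xs ! (Suc i mod ?l)" "xs ! j"] j k i cycle_adjacent[OF xs, of i]
      cycle_adjacent[OF xs, of j] adjacent_sym[of G x "xs ! j"] by auto
qed

section \<open>Rooted trees as parent maps\<close>

definition map_graph :: "'a set \<Rightarrow> ('a \<Rightarrow> 'a) \<Rightarrow> 'a ugraph" where
  "map_graph V f = \<lparr>verts = V, edges = {{v, f v} | v. v \<in> V \<and> f v \<noteq> v}\<rparr>"

lemma adjacent_map_graph:
  "adjacent (map_graph V f) u v \<longleftrightarrow> u \<noteq> v \<and> (u \<in> V \<and> f u = v \<or> v \<in> V \<and> f v = u)"
  by (auto simp: adjacent_def map_graph_def doubleton_eq_iff)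

text \<open>The case of a single root: a tree on \<open>V\<close> with every edge pointing towards
  \<open>r\<close>.\<close>

locale parent_map =
  fixes V :: "'a set" and f :: "'a \<Rightarrow> 'a" and r :: 'a
  assumes maps: "v \<in> V \<Longrightarrow> f v \<in> V"
    and fixed_iff: "v \<in> V \<Longrightarrow> f v = v \<longleftrightarrow> v = r"
    and rooted: "rooted V f"
begin

definition depth :: "'a \<Rightarrow> nat" where
  "depth v = (LEAST k. (f ^^ k) v = r)"

lemma reaches_root:
  assumes "v \<in> V"
  shows "(f ^^ depth v) v = r"
proof -
  have "(f ^^ k) v \<in> V" for k
    using assms maps by (induction k) auto
  then have "\<exists>k. (f ^^ k) v = r"
    using rooted assms fixed_iff unfolding rooted_def by metis
  then show ?thesis
    unfolding depth_def by (rule LeastI_ex)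
qed

text \<open>If \<open>v\<close> reaches \<open>r\<close> in \<open>Suc k\<close> steps, its parent
  does so in \<open>k\<close>. This strict decrease drives the inductions below and rules out
  cycles.\<close>

lemma depth_parent:
  assumes "v \<in> V" "f v \<noteq> v"
  shows "depth (f v) < depth v"
proof -
  have "depth v \<noteq> 0"
    using reaches_root[OF assms(1)] assms fixed_iff by (intro notI) simp
  then obtain k where k: "depth v = Suc k"
    using not0_implies_Suc by blast
  have "(f ^^ k) (f v) = r"
    using reaches_root[OF assms(1)] by (simp add: k funpow_swap1)
  then have "depth (f v) \<le> k"
    unfolding depth_def by (rule Least_le)
  then show ?thesis using k by simp
qed

lemma simple_map_graph: "simple_graph (map_graph V f)"
  using maps by (auto simp: simple_graph_def map_graph_def card_2_iff doubleton_eq_iff)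

lemma map_graph_reaches_root:
  assumes "v \<in> V"
  shows "(adjacent (map_graph V f))\<^sup>*\<^sup>* v r"
  using assms
proof (induction "depth v" arbitrary: v rule: less_induct)
  case less
  show ?case
  proof (cases "v = r")
    case False
    then have ne: "f v \<noteq> v" using fixed_iff less.prems by simp
    then have "(adjacent (map_graph V f))\<^sup>*\<^sup>* (f v) r"
      using less depth_parent maps by blast
    moreover have "adjacent (map_graph V f) v (f v)"
      using ne less.prems by (auto simp: adjacent_map_graph)
    ultimately show ?thesis by (rule converse_rtranclp_into_rtranclp[rotated])
  qed simp
qed

lemma map_graph_connected:
  assumes "u \<in> V" "v \<in> V"
  shows "(adjacent (map_graph V f))\<^sup>*\<^sup>* u v"
proof -
  have "symp (adjacent (map_graph V f))"
    by (rule sympI) (simp add: adjacent_sym)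
  then have "(adjacent (map_graph V f))\<^sup>*\<^sup>* r v"
    using map_graph_reaches_root[OF assms(2)] by (metis sympD symp_rtranclp)
  with map_graph_reaches_root[OF assms(1)] show ?thesis by (rule rtranclp_trans)
qed

text \<open>On a cycle, both neighbours of a vertex of maximal depth would have to be its parent.\<close>

lemma map_graph_acyclic: "\<not> is_cycle (map_graph V f) xs"
proof
  assume xs: "is_cycle (map_graph V f) xs"
  then have "finite (depth ` set xs)" "depth ` set xs \<noteq> {}"
    by (auto simp: is_cycle_def walk_def)
  then obtain x where x: "x \<in> set xs" and max: "\<And>y. y \<in> set xs \<Longrightarrow> depth y \<le> depth x"
    by (metis (no_types, lifting) Max_ge Max_in image_iff imageI)
  have "y = f x" if "y \<in> set xs" "adjacent (map_graph V f) x y" for y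
    using that max[of y] depth_parent[of y] by (auto simp: adjacent_map_graph)
  then show False
    using cycle_two_neighbours[OF xs x] by metis
qed

lemma is_tree_map_graph:
  assumes "r \<in> V"
  shows "is_tree (map_graph V f)"
  using simple_map_graph map_graph_acyclic assms
    rtranclp_imp_walk[OF simple_map_graph _ map_graph_connected]
  by (auto simp: is_tree_def connected_graph_def map_graph_def)

end

text \<open>The root fixes the orientation of a tree. The edge from \<open>v\<close> to
  \<open>f v\<close> must come from \<open>g\<close> as well, so either \<open>g v = f v\<close> or
  \<open>g (f v) = v\<close>. In the second case the induction hypothesis at \<open>f v\<close>
  gives \<open>f (f v) = v\<close>, and the depth would drop in both directions along one
  edge.\<close>

lemma parent_map_unique:
  assumes f: "parent_map V f r" and g: "parent_map V g r"
    and eq: "map_graph V f = map_graph V g" and "v \<in> V"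
  shows "f v = g v"
  using \<open>v \<in> V\<close>
proof (induction "parent_map.depth f r v" arbitrary: v rule: less_induct)
  case less
  interpret f: parent_map V f r by (rule f)
  interpret g: parent_map V g r by (rule g)
  show ?case
  proof (cases "v = r")
    case True
    then show ?thesis
      using less.prems f.fixed_iff g.fixed_iff by metis
  next
    case False
    then have ne: "f v \<noteq> v" using less.prems f.fixed_iff by simp
    have lt: "f.depth (f v) < f.depth v"
      using less.prems ne by (rule f.depth_parent)
    then have IH: "f (f v) = g (f v)"
      using less f.maps by blast
    have "adjacent (map_graph V g) v (f v)"
      using ne less.prems unfolding eq[symmetric] adjacent_map_graph by auto
    then consider "g v = f v" | "g (f v) = v"
      by (auto simp: adjacent_map_graph)
    then show ?thesis
    proof cases
      case 2
      then have "f.depth v < f.depth (f v)"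
        using f.depth_parent[of "f v"] IH f.maps less.prems ne by simp
      with lt show ?thesis by simp
    qed simp
  qed
qed

text \<open>Send each vertex to a neighbour nearer to \<open>r\<close>. The edges chosen in this way
  already connect all vertices, so a further edge of \<open>T\<close> would close a cycle.\<close>

lemma tree_imp_parent_map:
  assumes T: "is_tree T" and r: "r \<in> verts T"
  obtains f where "f \<in> verts T \<rightarrow>\<^sub>E verts T" "parent_map (verts T) f r" "map_graph (verts T) f = T"
proof -
  let ?V = "verts T"
  have simple: "simple_graph T" and conn: "connected_graph T" and acyc: "\<nexists>xs. is_cycle T xs"
    using T by (auto simp: is_tree_def)
  \<comment> \<open>The graph distance to \<open>r\<close>.\<close>
  define d where "d v = (LEAST k. (adjacent T ^^ k) v r)" for v
  have step: "\<exists>u. adjacent T v u \<and> d u < d v" if v: "v \<in> ?V" "v \<noteq> r" for v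
  proof -
    have "(adjacent T)\<^sup>*\<^sup>* v r"
      using conn v r walk_imp_rtranclp unfolding connected_graph_def by metis
    then have "\<exists>k. (adjacent T ^^ k) v r"
      by (simp add: rtranclp_power)
    then have *: "(adjacent T ^^ d v) v r"
      unfolding d_def by (rule LeastI_ex)
    then obtain k where k: "d v = Suc k"
      using v(2) by (cases "d v") auto
    then obtain u where u: "adjacent T v u" "(adjacent T ^^ k) u r"
      using * relpowp_Suc_D2 by metis
    then have "d u \<le> k"
      unfolding d_def by (intro Least_le)
    then show ?thesis using u k by auto
  qed
  \<comment> \<open>Restriction to \<open>?V\<close> makes \<open>f\<close> extensional, so that a
    tree with a chosen root corresponds to exactly one function.\<close>
  define f where "f = (\<lambda>v\<in>?V. if v = r then r else SOME u. adjacent T v u \<and> d u < d v)"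
  have f: "adjacent T v (f v)" "d (f v) < d v" if "v \<in> ?V" "v \<noteq> r" for v
    using someI_ex[OF step[OF that]] that by (simp_all add: f_def)
  have fr: "f r = r" using r by (simp add: f_def)
  have maps: "f v \<in> ?V" if "v \<in> ?V" for v
    using that fr f(1)[of v] adjacent_verts[OF simple] by (cases "v = r") auto
  have "\<exists>k. f ((f ^^ k) v) = (f ^^ k) v" if "v \<in> ?V" for v
    using that
  proof (induction "d v" arbitrary: v rule: less_induct)
    case less
    show ?case
    proof (cases "v = r")
      case True
      then show ?thesis using fr by (intro exI[of _ 0]) simp
    next
      case False
      then obtain k where "f ((f ^^ k) (f v)) = (f ^^ k) (f v)"
        using less f(2) maps by blast
      then show ?thesis by (intro exI[of _ "Suc k"]) (simp add: funpow_swap1)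
    qed
  qed
  moreover have "f v \<noteq> v" if "v \<in> ?V" "v \<noteq> r" for v
    using f(2)[OF that] by auto
  ultimately interpret parent_map ?V f r
    using maps fr by unfold_locales (auto simp: rooted_def)
  let ?H = "map_graph ?V f"
  have "adjacent T v (f v)" if "v \<in> ?V" "f v \<noteq> v" for v
    using that f(1)[of v] fr by (cases "v = r") auto
  then have sub: "adjacent T u v" if "adjacent ?H u v" for u v
    using that adjacent_sym[of T u v] by (auto simp: adjacent_map_graph)
  \<comment> \<open>A tree edge outside \<open>?H\<close>, together with a path of \<open>?H\<close>
    between its ends, would be a cycle of \<open>T\<close>.\<close>
  have "adjacent ?H u v" if uv: "adjacent T u v" for u v
  proof (rule ccontr)
    assume nH: "\<not> adjacent ?H u v"
    have V: "u \<in> ?V" "v \<in> ?V" "u \<noteq> v"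
      using adjacent_verts[OF simple uv] by auto
    then obtain xs where xs: "walk ?H xs" "distinct xs" "hd xs = u" "last xs = v"
      using rtranclp_imp_distinct_walk[OF simple_map_graph _ map_graph_connected, of u v]
      by (auto simp: map_graph_def)
    \<comment> \<open>One vertex would mean \<open>u = v\<close>; two would make \<open>u\<close>
      and \<open>v\<close> adjacent in \<open>?H\<close>.\<close>
    have "length xs \<ge> 3"
    proof (rule ccontr)
      assume "\<not> length xs \<ge> 3"
      then have "length xs = 0 \<or> length xs = Suc 0 \<or> length xs = Suc (Suc 0)" by linarith
      then show False
        using xs V(3) nH by (auto simp: walk_def length_Suc_conv)
    qed
    moreover have "walk T xs"
      using xs(1) sub by (auto simp: walk_def map_graph_def elim!: successively_mono)
    ultimately have "is_cycle T xs"
      using xs uv by (simp add: is_cycle_def adjacent_sym)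
    with acyc show False by blast
  qed
  with sub have adj: "adjacent ?H u v = adjacent T u v" for u v
    by blast
  have "e \<in> edges ?H \<longleftrightarrow> e \<in> edges T" for e
    using adj simple simple_map_graph unfolding adjacent_def simple_graph_def card_2_iff by metis
  then have "?H = T"
    by (intro ugraph.equality) (auto simp: map_graph_def)
  moreover have "f \<in> ?V \<rightarrow>\<^sub>E ?V"
    using maps by (auto simp: f_def)
  ultimately show thesis
    using that parent_map_axioms by blast
qed

text \<open>For a fixed root, \<open>map_graph\<close> is a bijection onto the spanning trees:
  \<open>parent_map_unique\<close> gives injectivity, orienting a tree towards \<open>r\<close>
  gives surjectivity.\<close>

lemma card_parent_maps:
  assumes "r \<in> verts G"
  shows "card {f \<in> verts G \<rightarrow>\<^sub>E verts G. parent_map (verts G) f r \<and> (\<forall>v\<in>verts G. f v \<noteq> v \<longrightarrow> adjacent G v (f v))}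
    = num_spanning_trees G" (is "card ?F = _")
proof -
  let ?V = "verts G"
  have "bij_betw (map_graph ?V) ?F {T. spanning_tree T G}"
    unfolding bij_betw_def
  proof (intro conjI inj_onI equalityI subsetI)
    fix f g assume f: "f \<in> ?F" and g: "g \<in> ?F" and eq: "map_graph ?V f = map_graph ?V g"
    show "f = g"
    proof (rule PiE_ext)
      show "f \<in> ?V \<rightarrow>\<^sub>E ?V" "g \<in> ?V \<rightarrow>\<^sub>E ?V" using f g by auto
      show "f v = g v" if "v \<in> ?V" for v
        using parent_map_unique[OF _ _ eq that] f g by blast
    qed
  next
    fix T assume "T \<in> map_graph ?V ` ?F"
    then obtain f where T: "T = map_graph ?V f" and "parent_map ?V f r"
      and adj: "\<forall>v\<in>?V. f v \<noteq> v \<longrightarrow> adjacent G v (f v)" by auto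
    then interpret parent_map ?V f r by simp
    have "edges T \<subseteq> edges G"
      using adj by (auto simp: T map_graph_def adjacent_def)
    then show "T \<in> {T. spanning_tree T G}"
      using is_tree_map_graph[OF assms] simple_map_graph
      by (auto simp: spanning_tree_def subgraph_def T map_graph_def)
  next
    fix T assume "T \<in> {T. spanning_tree T G}"
    then have tree: "is_tree T" and verts: "verts T = ?V" and sub: "edges T \<subseteq> edges G"
      by (auto simp: spanning_tree_def subgraph_def)
    obtain f where f: "f \<in> ?V \<rightarrow>\<^sub>E ?V" "parent_map ?V f r" "map_graph ?V f = T"
      using tree_imp_parent_map[OF tree, of r] assms unfolding verts by blast
    have "adjacent G v (f v)" if "v \<in> ?V" "f v \<noteq> v" for v
    proof -
      have "adjacent (map_graph ?V f) v (f v)"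
        using that by (auto simp: adjacent_map_graph)
      then show ?thesis
        using sub unfolding f(3) adjacent_def by blast
    qed
    then show "T \<in> map_graph ?V ` ?F"
      using f by blast
  qed
  then show ?thesis
    unfolding num_spanning_trees_def by (rule bij_betw_same_card)
qed

text \<open>Sort the maps by their unique fixed point. Every vertex can serve as the root of every
  spanning tree, hence the factor \<open>card (verts G)\<close>.\<close>

lemma card_rooted_maps:
  assumes fin: "finite (verts G)"
  shows "card {f \<in> verts G \<rightarrow>\<^sub>E verts G. rooted (verts G) f \<and> (\<forall>v\<in>verts G. f v \<noteq> v \<longrightarrow> adjacent G v (f v))
      \<and> card {v \<in> verts G. f v = v} = 1} = card (verts G) * num_spanning_trees G"
    (is "card ?F = _")
proof -
  let ?V = "verts G"
  let ?Fr = "\<lambda>r. {f \<in> ?V \<rightarrow>\<^sub>E ?V. parent_map ?V f r \<and> (\<forall>v\<in>?V. f v \<noteq> v \<longrightarrow> adjacent G v (f v))}"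
  have "?F = (\<Union>r\<in>?V. ?Fr r)"
  proof (intro equalityI subsetI)
    fix f assume f: "f \<in> ?F"
    then obtain r where r: "{v \<in> ?V. f v = v} = {r}"
      by (auto simp: card_1_singleton_iff)
    then have "r \<in> ?V" and "\<And>v. v \<in> ?V \<Longrightarrow> f v = v \<longleftrightarrow> v = r" by auto
    moreover from this have "parent_map ?V f r"
      using f by unfold_locales auto
    ultimately show "f \<in> (\<Union>r\<in>?V. ?Fr r)"
      using f by blast
  next
    fix f assume "f \<in> (\<Union>r\<in>?V. ?Fr r)"
    then obtain r where r: "r \<in> ?V" and f: "f \<in> ?Fr r" by blast
    then interpret parent_map ?V f r by simp
    have "{v \<in> ?V. f v = v} = {r}"
      using r fixed_iff by auto
    then show "f \<in> ?F"
      using f rooted by simp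
  qed
  moreover have "card (\<Union>r\<in>?V. ?Fr r) = (\<Sum>r\<in>?V. card (?Fr r))"
  proof (intro card_UN_disjoint ballI impI)
    show "finite (?Fr r)" for r
      using fin by (simp add: finite_PiE)
    show "?Fr r \<inter> ?Fr s = {}" if "r \<in> ?V" "s \<in> ?V" "r \<noteq> s" for r s
      using that parent_map.fixed_iff[of ?V _ r r] parent_map.fixed_iff[of ?V _ s r] by auto
  qed (rule fin)
  ultimately show ?thesis
    by (simp add: card_parent_maps)
qed

section \<open>Determinants and rooted forests\<close>

text \<open>The Leibniz formula with \<open>V\<close> itself as index set, so that the vertices need
  no enumeration.\<close>

definition det_on :: "'a set \<Rightarrow> ('a \<Rightarrow> 'a \<Rightarrow> 'b) \<Rightarrow> 'b :: comm_ring_1" where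
  "det_on V M = (\<Sum>p | p permutes V. of_int (sign p) * (\<Prod>v\<in>V. M v (p v)))"

lemma det_on_cong:
  assumes "\<And>u v. u \<in> V \<Longrightarrow> v \<in> V \<Longrightarrow> M u v = M' u v"
  shows "det_on V M = det_on V M'"
  unfolding det_on_def
  by (intro sum.cong refl arg_cong2[of _ _ _ _ "(*)"] prod.cong assms)
    (auto simp: permutes_in_image)

text \<open>Relabelling along \<open>b\<close> carries permutations to permutations and keeps their
  signs, so the Leibniz sums agree term by term. Multiplicativity and the kernel criterion are
  transferred from \<open>det\<close> in this way.\<close>

lemma det_on_eq_det:
  assumes b: "bij_betw b {0..<N} V"
  shows "det_on V M = det (mat N N (\<lambda>(i, j). M (b i) (b j)))"
proof -
  have inj: "inj_on b {0..<N}" and img: "b ` {0..<N} = V"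
    using b by (auto simp: bij_betw_def)
  define h where "h = (\<lambda>p. map_permutation {0..<N} b p)"
  have h_eq: "h p = (\<lambda>x. if x \<in> V then b (p (inv_into {0..<N} b x)) else x)" for p
    by (auto simp: h_def map_permutation_def restrict_id_def img fun_eq_iff)
  have "bij_betw h {p. p permutes {0..<N}} {p. p permutes V}"
    using bij_betw_permutations[OF b] unfolding h_eq[abs_def] .
  then have "det_on V M = (\<Sum>p | p permutes {0..<N}. of_int (sign (h p)) * (\<Prod>v\<in>V. M v (h p v)))"
    unfolding det_on_def by (rule sum.reindex_bij_betw[symmetric])
  also have "\<dots> = (\<Sum>p | p permutes {0..<N}. of_int (sign p) * (\<Prod>i\<in>{0..<N}. M (b i) (b (p i))))"
  proof (intro sum.cong refl)
    fix p assume "p \<in> {p. p permutes {0..<N}}"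
    then have p: "p permutes {0..<N}" by simp
    have "sign (h p) = sign p"
      unfolding h_def using inj p by (simp add: sign_map_permutation)
    moreover have "(\<Prod>v\<in>V. M v (h p v)) = (\<Prod>i\<in>{0..<N}. M (b i) (h p (b i)))"
      by (rule prod.reindex_bij_betw[OF b, symmetric])
    moreover have "\<dots> = (\<Prod>i\<in>{0..<N}. M (b i) (b (p i)))"
      by (intro prod.cong refl) (simp add: h_def map_permutation_apply[OF inj])
    ultimately show "of_int (sign (h p)) * (\<Prod>v\<in>V. M v (h p v)) =
        of_int (sign p) * (\<Prod>i\<in>{0..<N}. M (b i) (b (p i)))" by simp
  qed
  also have "\<dots> = det (mat N N (\<lambda>(i, j). M (b i) (b j)))"
    unfolding det_def'[OF mat_carrier]
  proof (intro sum.cong refl arg_cong2[of _ _ _ _ "(*)"] prod.cong)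
    fix p i assume "p \<in> {p. p permutes {0..<N}}" and i: "i \<in> {0..<N}"
    then have "p i \<in> {0..<N}"
      by (simp only: mem_Collect_eq permutes_in_image)
    with i show "M (b i) (b (p i)) = mat N N (\<lambda>(i, j). M (b i) (b j)) $$ (i, p i)"
      by simp
  qed
  finally show ?thesis .
qed

lemma det_on_mult:
  assumes "finite V"
  shows "det_on V (\<lambda>u v. \<Sum>w\<in>V. A u w * B w v) = det_on V A * det_on V B"
proof -
  obtain b where b: "bij_betw b {0..<card V} V"
    using ex_bij_betw_nat_finite[OF assms] by blast
  let ?m = "\<lambda>M. mat (card V) (card V) (\<lambda>(i, j). M (b i) (b j))"
  have "?m (\<lambda>u v. \<Sum>w\<in>V. A u w * B w v) = ?m A * ?m B"
    by (intro eq_matI) (auto simp: scalar_prod_def sum.reindex_bij_betw[OF b, symmetric])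
  then show ?thesis
    unfolding det_on_eq_det[OF b] by (simp add: det_mult[where n = "card V"])
qed

lemma det_on_eq_0:
  fixes M :: "'a \<Rightarrow> 'a \<Rightarrow> 'b :: field"
  assumes "finite V" and "v \<in> V" and "x v \<noteq> 0"
    and "\<And>u. u \<in> V \<Longrightarrow> (\<Sum>w\<in>V. M u w * x w) = 0"
  shows "det_on V M = 0"
proof -
  obtain b where b: "bij_betw b {0..<card V} V"
    using ex_bij_betw_nat_finite[OF assms(1)] by blast
  let ?m = "mat (card V) (card V) (\<lambda>(i, j). M (b i) (b j))"
  let ?y = "vec (card V) (\<lambda>i. x (b i))"
  have "b i \<in> V" if "i < card V" for i
    using b that by (auto simp: bij_betw_def)
  then have "?m *\<^sub>v ?y = 0\<^sub>v (card V)"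
    using assms(4)
    by (intro eq_vecI) (simp_all add: scalar_prod_def
      sum.reindex_bij_betw[OF b, of "\<lambda>w. M (b i) w * x w" for i])
  moreover obtain i where i: "i < card V" "b i = v"
    using b \<open>v \<in> V\<close> unfolding bij_betw_def by force
  have "?y $ i \<noteq> 0\<^sub>v (card V) $ i"
    using i \<open>x v \<noteq> 0\<close> by simp
  then have "?y \<noteq> 0\<^sub>v (card V)"
    by metis
  ultimately show ?thesis
    unfolding det_on_eq_det[OF b]
    by (subst det_0_iff_vec_prod_zero_field) (auto intro!: exI[of _ ?y])
qed

text \<open>If a nontrivial permutation contributed, a moved point of least rank would have an image
  that is also moved and has smaller rank.\<close>

lemma det_on_rank:
  fixes rank :: "'a \<Rightarrow> nat"
  assumes fin: "finite V"
    and rank: "\<And>u v. u \<in> V \<Longrightarrow> v \<in> V \<Longrightarrow> u \<noteq> v \<Longrightarrow> M u v \<noteq> 0 \<Longrightarrow> rank v < rank u"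
  shows "det_on V M = (\<Prod>v\<in>V. M v v)"
proof -
  have "(\<Prod>v\<in>V. M v (p v)) = 0" if p: "p permutes V" and "p \<noteq> id" for p
  proof (rule ccontr)
    assume "(\<Prod>v\<in>V. M v (p v)) \<noteq> 0"
    then have nz: "M v (p v) \<noteq> 0" if "v \<in> V" for v
      using fin that by (metis prod_zero)
    have "p v = v" if "v \<in> V" for v
      using that
    proof (induction "rank v" arbitrary: v rule: less_induct)
      case less
      show ?case
      proof (rule ccontr)
        assume ne: "p v \<noteq> v"
        have pv: "p v \<in> V" using p less.prems by (simp add: permutes_in_image)
        with ne have "rank (p v) < rank v"
          using rank[of v "p v"] nz less.prems by auto
        then have "p (p v) = p v" using less.hyps pv by blast
        then show False using ne permutes_inj[OF p] by (auto dest: injD)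
      qed
    qed
    then show False
      using \<open>p \<noteq> id\<close> p by (metis eq_id_iff permutes_not_in)
  qed
  then have "det_on V M = (\<Sum>p | p permutes V. if p = id then (\<Prod>v\<in>V. M v v) else 0)"
    unfolding det_on_def by (intro sum.cong) auto
  then show ?thesis
    using fin by (simp add: finite_permutations permutes_id)
qed

text \<open>Multilinearity in all rows at once; \<open>f\<close> records which summand is taken in
  each row.\<close>

lemma det_on_row_expansion:
  assumes "finite V"
  shows "det_on V (\<lambda>v u. \<Sum>w\<in>V. c v w * q v w u) =
    (\<Sum>f\<in>V \<rightarrow>\<^sub>E V. (\<Prod>v\<in>V. c v (f v)) * det_on V (\<lambda>v. q v (f v)))"
proof -
  have "det_on V (\<lambda>v u. \<Sum>w\<in>V. c v w * q v w u) =
     (\<Sum>p | p permutes V. \<Sum>f\<in>V \<rightarrow>\<^sub>E V. of_int (sign p) * (\<Prod>v\<in>V. c v (f v) * q v (f v) (p v)))"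
    unfolding det_on_def using assms by (simp add: prod_sum_PiE sum_distrib_left)
  also have "\<dots> = (\<Sum>f\<in>V \<rightarrow>\<^sub>E V. \<Sum>p | p permutes V. of_int (sign p) * (\<Prod>v\<in>V. c v (f v) * q v (f v) (p v)))"
    by (rule sum.swap)
  finally show ?thesis
    by (simp add: det_on_def sum_distrib_left prod.distrib mult_ac)
qed

text \<open>The choice \<open>w = v\<close> stands for making \<open>v\<close> a root, in accordance with \<open>rooted\<close>.\<close>

definition edge_row :: "'a \<Rightarrow> 'a \<Rightarrow> 'a \<Rightarrow> real" where
  "edge_row v w u = of_bool (u = v) - of_bool (w \<noteq> v \<and> u = w)"

text \<open>If every vertex reaches a root, the number of steps needed is a rank that leaves only
  the diagonal, which consists of ones. Otherwise the matrix is singular.\<close>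

lemma det_on_edge_row:
  assumes fin: "finite V" and f: "f \<in> V \<rightarrow> V"
  shows "det_on V (\<lambda>v. edge_row v (f v)) = of_bool (rooted V f)"
proof (cases "rooted V f")
  case True
  define rank where "rank v = (LEAST k. f ((f ^^ k) v) = (f ^^ k) v)" for v
  have "rank (f v) < rank v" if "v \<in> V" "f v \<noteq> v" for v
  proof -
    have ex: "f ((f ^^ rank v) v) = (f ^^ rank v) v"
      unfolding rank_def using True that
      by (intro LeastI_ex[of "\<lambda>k. f ((f ^^ k) v) = (f ^^ k) v"]) (auto simp: rooted_def)
    then have "rank v \<noteq> 0"
      using that by (intro notI) simp
    then obtain k where k: "rank v = Suc k"
      using not0_implies_Suc by blast
    have "f ((f ^^ k) (f v)) = (f ^^ k) (f v)"
      using ex unfolding k by (simp add: funpow_swap1)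
    then have "rank (f v) \<le> k"
      unfolding rank_def by (rule Least_le)
    then show ?thesis using k by simp
  qed
  then have "det_on V (\<lambda>v. edge_row v (f v)) = (\<Prod>v\<in>V. edge_row v (f v) v)"
    using fin by (intro det_on_rank[where rank = rank]) (auto simp: edge_row_def split: if_splits)
  also have "\<dots> = 1"
    by (intro prod.neutral) (auto simp: edge_row_def)
  finally show ?thesis using True by simp
next
  case False
  \<comment> \<open>The indicator function of the vertices that never reach a root lies in the kernel.\<close>
  define C where "C = {v. \<forall>k. f ((f ^^ k) v) \<noteq> (f ^^ k) v}"
  \<comment> \<open>Never reaching a fixed point is a property that \<open>v\<close> shares with its
    parent; \<open>f v \<noteq> v\<close> settles the case \<open>k = 0\<close>.\<close>
  have C_step: "f v \<in> C \<longleftrightarrow> v \<in> C" if "f v \<noteq> v" for v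
  proof
    assume *: "f v \<in> C"
    have "f ((f ^^ k) v) \<noteq> (f ^^ k) v" for k
      using * that by (cases k) (auto simp: C_def funpow_swap1)
    then show "v \<in> C" by (simp add: C_def)
  next
    assume *: "v \<in> C"
    have "f ((f ^^ k) (f v)) \<noteq> (f ^^ k) (f v)" for k
      using * unfolding C_def by (auto dest: spec[of _ "Suc k"] simp: funpow_swap1)
    then show "f v \<in> C" by (simp add: C_def)
  qed
  have C_fix: "v \<notin> C" if "f v = v" for v
    using that by (auto simp: C_def intro!: exI[of _ 0])
  obtain v where v: "v \<in> V" "v \<in> C"
    using False by (auto simp: rooted_def C_def)
  have "det_on V (\<lambda>v. edge_row v (f v)) = 0"
  proof (rule det_on_eq_0[OF fin v(1), where x = "\<lambda>v. of_bool (v \<in> C)"])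
    show "of_bool (v \<in> C) \<noteq> (0::real)" using v by simp
  next
    fix u assume u: "u \<in> V"
    then have fu: "f u \<in> V" using f by auto
    have "(\<Sum>w\<in>V. edge_row u (f u) w * of_bool (w \<in> C)) =
      (\<Sum>w\<in>V. if w = u then of_bool (u \<in> C) else 0) - (\<Sum>w\<in>V. if w = f u then of_bool (f u \<noteq> u \<and> f u \<in> C) else (0::real))"
      unfolding sum_subtractf[symmetric] by (intro sum.cong) (auto simp: edge_row_def)
    also have "\<dots> = of_bool (u \<in> C) - of_bool (f u \<noteq> u \<and> f u \<in> C)"
      using fin u fu by simp
    also have "\<dots> = 0"
      using C_step[of u] C_fix[of u] by auto
    finally show "(\<Sum>w\<in>V. edge_row u (f u) w * of_bool (w \<in> C)) = 0" .
  qed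
  then show ?thesis using False by simp
qed

text \<open>Row \<open>v\<close> of t I + L is \<open>t\<close> times the unit row
  \<open>edge_row v v\<close> plus \<open>edge_row v w\<close> for each neighbour \<open>w\<close>.
  In the row expansion only the rooted forests along \<open>R\<close> survive, with one factor
  \<open>t\<close> per root.\<close>

lemma det_on_laplacian:
  assumes fin: "finite V"
  shows "det_on V (\<lambda>v u. \<Sum>w\<in>V. (if w = v then t else of_bool (R v w)) * edge_row v w u) =
    (\<Sum>f | f \<in> V \<rightarrow>\<^sub>E V \<and> rooted V f \<and> (\<forall>v\<in>V. f v \<noteq> v \<longrightarrow> R v (f v)). t ^ card {v\<in>V. f v = v})"
proof -
  have "(\<Prod>v\<in>V. if f v = v then t else of_bool (R v (f v))) =
    of_bool (\<forall>v\<in>V. f v \<noteq> v \<longrightarrow> R v (f v)) * t ^ card {v\<in>V. f v = v}" for f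
  proof (cases "\<forall>v\<in>V. f v \<noteq> v \<longrightarrow> R v (f v)")
    case True
    then have "(\<Prod>v\<in>V. if f v = v then t else of_bool (R v (f v))) = (\<Prod>v\<in>V. if f v = v then t else 1)"
      by (intro prod.cong) auto
    also have "\<dots> = (\<Prod>v | v \<in> V \<and> f v = v. t)"
      using fin by (simp flip: prod.inter_filter)
    finally show ?thesis using True by simp
  next
    case False
    then show ?thesis using fin by (auto intro!: prod_zero)
  qed
  then have "det_on V (\<lambda>v u. \<Sum>w\<in>V. (if w = v then t else of_bool (R v w)) * edge_row v w u) =
    (\<Sum>f\<in>V \<rightarrow>\<^sub>E V. of_bool (\<forall>v\<in>V. f v \<noteq> v \<longrightarrow> R v (f v)) * t ^ card {v\<in>V. f v = v} * of_bool (rooted V f))"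
    unfolding det_on_row_expansion[OF fin]
    by (intro sum.cong refl) (use det_on_edge_row[OF fin] in \<open>simp add: PiE_def\<close>)
  also have "\<dots> = (\<Sum>f | f \<in> V \<rightarrow>\<^sub>E V \<and> rooted V f \<and> (\<forall>v\<in>V. f v \<noteq> v \<longrightarrow> R v (f v)). t ^ card {v\<in>V. f v = v})"
    using fin by (intro sum.mono_neutral_cong_right) (auto simp: finite_PiE)
  finally show ?thesis .
qed

text \<open>Identifies the matrix of \<open>det_on_laplacian\<close> as t I + L by its action on a
  function \<open>x\<close>, the form in which eigenvectors are checked.\<close>

lemma laplacian_apply:
  assumes fin: "finite V" and v: "v \<in> V" and irrefl: "\<not> R v v"
  shows "(\<Sum>u\<in>V. (\<Sum>w\<in>V. (if w = v then t else of_bool (R v w)) * edge_row v w u) * x u) =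
    t * x v + (\<Sum>w | w \<in> V \<and> R v w. x v - x w)"
proof -
  have row: "(\<Sum>u\<in>V. edge_row v w u * x u) = x v - of_bool (w \<noteq> v) * x w" if "w \<in> V" for w
  proof -
    have "(\<Sum>u\<in>V. edge_row v w u * x u) =
      (\<Sum>u\<in>V. if u = v then x v else 0) - (\<Sum>u\<in>V. if u = w then of_bool (w \<noteq> v) * x w else 0)"
      unfolding sum_subtractf[symmetric] by (intro sum.cong) (auto simp: edge_row_def)
    then show ?thesis using fin v that by simp
  qed
  have "(\<Sum>u\<in>V. (\<Sum>w\<in>V. (if w = v then t else of_bool (R v w)) * edge_row v w u) * x u) =
    (\<Sum>w\<in>V. (if w = v then t else of_bool (R v w)) * (\<Sum>u\<in>V. edge_row v w u * x u))"
    unfolding sum_distrib_right sum_distrib_left mult.assoc by (rule sum.swap)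
  also have "\<dots> = (\<Sum>w\<in>V. (if w = v then t * x v else 0) + (if R v w then x v - x w else 0))"
    using irrefl by (intro sum.cong) (auto simp: row)
  also have "\<dots> = t * x v + (\<Sum>w | w \<in> V \<and> R v w. x v - x w)"
    using fin v by (simp add: sum.distrib sum.inter_filter)
  finally show ?thesis .
qed

section \<open>The spectrum of the cube\<close>

lemma verts_cube: "verts (cube n) = {1..n} \<rightarrow>\<^sub>E {0, 1}"
proof -
  have "{0..<2} = {0, 1::int}" by auto
  then show ?thesis
    by (simp add: cube_def cayley_graph_def cube_group_def carrier_integer_mod_group)
qed

lemma card_verts_cube: "card (verts (cube n)) = 2 ^ n"
  by (simp add: verts_cube card_PiE numeral_2_eq_2)

text \<open>Addition of the \<open>i\<close>-th unit vector modulo 2, since \<open>1 - x\<close>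
  exchanges 0 and 1.\<close>

definition flip :: "nat \<Rightarrow> (nat \<Rightarrow> int) \<Rightarrow> nat \<Rightarrow> int" where
  "flip i v = v(i := 1 - v i)"

lemma cube_val:
  assumes "v \<in> verts (cube n)" "i \<in> {1..n}"
  shows "v i = 0 \<or> v i = 1"
  using assms PiE_mem[of v "{1..n}" "\<lambda>_. {0, 1}"] unfolding verts_cube by auto

lemma cube_undefined:
  assumes "v \<in> verts (cube n)" "i \<notin> {1..n}"
  shows "v i = undefined"
  using assms PiE_arb unfolding verts_cube by metis

lemma flip_in_cube:
  assumes v: "v \<in> verts (cube n)" and i: "i \<in> {1..n}"
  shows "flip i v \<in> verts (cube n)"
  unfolding verts_cube
proof (rule PiE_I)
  show "flip i v j \<in> {0, 1}" if "j \<in> {1..n}" for j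
    using cube_val[OF v that] by (auto simp: flip_def)
  show "flip i v j = undefined" if "j \<notin> {1..n}" for j
    using cube_undefined[OF v that] i that by (cases "j = i") (simp_all add: flip_def)
qed

text \<open>The generators are the unit vectors, so neighbours can be indexed by the coordinate that
  changes.\<close>

lemma adjacent_cube_flip:
  assumes v: "v \<in> verts (cube n)" and u: "u \<in> verts (cube n)"
  shows "adjacent (cube n) v u \<longleftrightarrow> (\<exists>i\<in>{1..n}. u = flip i v)"
proof -
  have carrier: "carrier (cube_group n) = verts (cube n)"
    by (simp add: cube_def cayley_graph_def)
  have add_unit: "v \<otimes>\<^bsub>cube_group n\<^esub> s = flip i v"
    if i: "i \<in> {1..n}" and s: "\<And>j. j \<in> {1..n} \<Longrightarrow> s j = (if j = i then 1 else 0)" for s i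
  proof
    fix j
    have mult: "(v \<otimes>\<^bsub>cube_group n\<^esub> s) j = (if j \<in> {1..n} then (v j + s j) mod 2 else undefined)"
      by (simp add: cube_group_def)
    show "(v \<otimes>\<^bsub>cube_group n\<^esub> s) j = flip i v j"
    proof (cases "j \<in> {1..n}")
      case True
      show ?thesis
        using cube_val[OF v True] unfolding mult flip_def s[OF True] if_P[OF True]
        by (elim disjE; cases "j = i") simp_all
    next
      case False
      with i have "j \<noteq> i" by blast
      then show ?thesis
        unfolding mult flip_def if_not_P[OF False] using cube_undefined[OF v False] by simp
    qed
  qed
  have "(\<exists>s\<in>cube_generators n. u = v \<otimes>\<^bsub>cube_group n\<^esub> s) \<longleftrightarrow> (\<exists>i\<in>{1..n}. u = flip i v)"
  proof
    assume "\<exists>s\<in>cube_generators n. u = v \<otimes>\<^bsub>cube_group n\<^esub> s"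
    then obtain s where gen: "s \<in> cube_generators n" and u_eq: "u = v \<otimes>\<^bsub>cube_group n\<^esub> s" ..
    have s: "s \<in> verts (cube n)" and "\<exists>!i. i \<in> {1..n} \<and> s i = 1"
      using gen unfolding cube_generators_def carrier by simp_all
    then obtain i where i: "i \<in> {1..n}" "s i = 1"
      and uniq: "\<And>j. j \<in> {1..n} \<Longrightarrow> s j = 1 \<Longrightarrow> j = i"
      by (elim ex1E) blast
    have "s j = (if j = i then 1 else 0)" if "j \<in> {1..n}" for j
      using cube_val[OF s that] uniq[OF that] i(2) by metis
    with i(1) have "u = flip i v"
      unfolding u_eq by (rule add_unit)
    with i(1) show "\<exists>i\<in>{1..n}. u = flip i v" ..
  next
    assume "\<exists>i\<in>{1..n}. u = flip i v"
    then obtain i where i: "i \<in> {1..n}" and u_eq: "u = flip i v" ..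
    define s where "s = (\<lambda>j\<in>{1..n}. if j = i then 1 else 0 :: int)"
    have s: "s j = (if j = i then 1 else 0)" if "j \<in> {1..n}" for j
      unfolding s_def using that by (rule restrict_apply')
    have "s \<in> verts (cube n)"
      by (auto simp: verts_cube s_def)
    moreover have "\<exists>!j. j \<in> {1..n} \<and> s j = 1"
      using i s by (metis zero_neq_one)
    ultimately have "s \<in> cube_generators n"
      unfolding cube_generators_def carrier by simp
    moreover have "u = v \<otimes>\<^bsub>cube_group n\<^esub> s"
      unfolding u_eq using i s by (rule add_unit[symmetric])
    ultimately show "\<exists>s\<in>cube_generators n. u = v \<otimes>\<^bsub>cube_group n\<^esub> s"
      by blast
  qed
  then show ?thesis
    using adjacent_cube_iff[of v n u] v u by (simp add: carrier)
qed

text \<open>The group character (-1)^(s . v): for entries 0 and 1, each factor is -1 exactly when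
  both entries are 1. It is symmetric in \<open>s\<close> and \<open>v\<close>.\<close>

definition character :: "nat \<Rightarrow> (nat \<Rightarrow> int) \<Rightarrow> (nat \<Rightarrow> int) \<Rightarrow> real" where
  "character n s v = (\<Prod>i=1..n. of_int (1 - 2 * s i * v i))"

definition support :: "nat \<Rightarrow> (nat \<Rightarrow> int) \<Rightarrow> nat set" where
  "support n s = {i \<in> {1..n}. s i = 1}"

lemma character_flip:
  assumes s: "s \<in> verts (cube n)" and v: "v \<in> verts (cube n)" and i: "i \<in> {1..n}"
  shows "character n s (flip i v) = of_int (1 - 2 * s i) * character n s v"
proof -
  have "character n s (flip i v) = (\<Prod>j\<in>{1..n}. (if j = i then of_int (1 - 2 * s i) else 1) * of_int (1 - 2 * s j * v j))"
    unfolding character_def using cube_val[OF s] cube_val[OF v]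
    by (intro prod.cong) (fastforce simp: flip_def)+
  also have "\<dots> = of_int (1 - 2 * s i) * character n s v"
    using i by (simp add: prod.distrib character_def)
  finally show ?thesis .
qed

text \<open>The eigenvalue equation for L. A flip inside the support of \<open>s\<close> reverses
  the sign of the character and contributes twice its value; any other flip contributes 0.\<close>

lemma sum_character_neighbours:
  assumes s: "s \<in> verts (cube n)" and v: "v \<in> verts (cube n)"
  shows "(\<Sum>w | w \<in> verts (cube n) \<and> adjacent (cube n) v w. character n s v - character n s w) =
    2 * card (support n s) * character n s v"
proof -
  have "{w \<in> verts (cube n). adjacent (cube n) v w} = (\<lambda>i. flip i v) ` {1..n}"
    using adjacent_cube_flip[OF v] flip_in_cube[OF v] by blast
  moreover have "inj_on (\<lambda>i. flip i v) {1..n}"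
  proof (rule inj_onI)
    fix i j assume "flip i v = flip j v"
    \<comment> \<open>For \<open>i \<noteq> j\<close>, coordinate \<open>i\<close> would give
      \<open>1 - v i = v i\<close>, impossible for an integer.\<close>
    from fun_cong[OF this, of i] show "i = j"
      by (cases "i = j") (simp_all add: flip_def, presburger)
  qed
  ultimately have "(\<Sum>w | w \<in> verts (cube n) \<and> adjacent (cube n) v w. character n s v - character n s w)
    = (\<Sum>i\<in>{1..n}. character n s v - character n s (flip i v))"
    by (simp add: sum.reindex)
  also have "\<dots> = (\<Sum>i\<in>{1..n}. if s i = 1 then 2 * character n s v else 0)"
    using cube_val[OF s] by (intro sum.cong) (auto simp: character_flip[OF s v])
  also have "\<dots> = 2 * card (support n s) * character n s v"
    by (simp add: support_def flip: sum.inter_filter)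
  finally show ?thesis .
qed

text \<open>The sum over the cube factors into one sum over {0, 1} per coordinate, which is 1 + 1 if
  \<open>s\<close> and \<open>u\<close> agree there and 1 - 1 if not.\<close>

lemma character_orthogonal:
  assumes s: "s \<in> verts (cube n)" and u: "u \<in> verts (cube n)"
  shows "(\<Sum>v\<in>verts (cube n). character n s v * character n v u) = (if s = u then 2 ^ n else 0)"
proof -
  have "(\<Sum>v\<in>verts (cube n). character n s v * character n v u) =
    (\<Sum>v\<in>{1..n} \<rightarrow>\<^sub>E {0, 1}. \<Prod>i\<in>{1..n}. of_int ((1 - 2 * s i * v i) * (1 - 2 * v i * u i)))"
    unfolding verts_cube character_def prod.distrib[symmetric] of_int_mult ..
  also have "\<dots> = (\<Prod>i\<in>{1..n}. \<Sum>x\<in>{0, 1}. of_int ((1 - 2 * s i * x) * (1 - 2 * x * u i)))"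
    by (rule prod_sum_PiE[symmetric]) auto
  also have "\<dots> = (\<Prod>i\<in>{1..n}. if s i = u i then 2 else 0)"
    using cube_val[OF s] cube_val[OF u] by (intro prod.cong) fastforce+
  also have "\<dots> = (if s = u then 2 ^ n else 0)"
  proof (cases "s = u")
    case False
    then obtain i where i: "s i \<noteq> u i" by blast
    \<comment> \<open>Outside this range both functions are \<open>undefined\<close> and thus
      agree.\<close>
    then have "i \<in> {1..n}"
      using cube_undefined[OF s, of i] cube_undefined[OF u, of i] by metis
    with i False show ?thesis by auto
  qed simp
  finally show ?thesis .
qed

text \<open>The square of the character matrix is \<open>2 ^ n\<close> times the identity.\<close>

lemma det_on_character: "det_on (verts (cube n)) (\<lambda>v s. character n v s) \<noteq> 0"
proof -
  let ?V = "verts (cube n)"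
  have "det_on ?V (character n) * det_on ?V (character n) =
    det_on ?V (\<lambda>s u. \<Sum>v\<in>?V. character n s v * character n v u)"
    by (rule det_on_mult[OF finite_verts_cube, symmetric])
  also have "\<dots> = det_on ?V (\<lambda>s u. if s = u then 2 ^ n else 0)"
    by (intro det_on_cong character_orthogonal)
  also have "\<dots> = (\<Prod>s\<in>?V. 2 ^ n)"
    \<comment> \<open>Off-diagonal entries vanish, so a constant rank will do.\<close>
    by (subst det_on_rank[OF finite_verts_cube, where rank = "\<lambda>_. 0"]) (auto split: if_splits)
  finally show ?thesis by auto
qed

text \<open>With H the character matrix and D the diagonal matrix of eigenvalues, M H = H D;
  cancelling the nonzero determinant of H leaves that of D.\<close>

lemma det_on_cube_laplacian:
  fixes t :: real
  defines "V n \<equiv> verts (cube n)"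
  shows "det_on (V n) (\<lambda>v u. \<Sum>w\<in>V n. (if w = v then t else of_bool (adjacent (cube n) v w)) * edge_row v w u)
    = (\<Prod>s\<in>V n. t + 2 * card (support n s))" (is "det_on _ ?M = _")
proof -
  have fin: "finite (V n)" by (simp add: V_def finite_verts_cube)
  let ?H = "\<lambda>v s. character n s v"
  let ?e = "\<lambda>s. t + 2 * card (support n s)"
  have H: "det_on (V n) ?H \<noteq> 0"
  proof -
    have "?H = character n" by (auto simp: character_def fun_eq_iff mult_ac)
    then show ?thesis using det_on_character by (simp add: V_def)
  qed
  have "det_on (V n) ?M * det_on (V n) ?H = det_on (V n) (\<lambda>v s. \<Sum>u\<in>V n. ?M v u * ?H u s)"
    by (rule det_on_mult[OF fin, symmetric])
  also have "\<dots> = det_on (V n) (\<lambda>v s. \<Sum>u\<in>V n. ?H v u * (if u = s then ?e s else 0))"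
  proof (rule det_on_cong)
    fix v s assume v: "v \<in> V n" and s: "s \<in> V n"
    have "\<not> adjacent (cube n) v v"
      using adjacent_verts(3)[OF simple_graph_cube] by blast
    then have "(\<Sum>u\<in>V n. ?M v u * ?H u s) = ?e s * ?H v s"
      using sum_character_neighbours[of s n v] v s
      by (subst laplacian_apply[OF fin v]) (simp_all add: V_def algebra_simps)
    also have "\<dots> = (\<Sum>u\<in>V n. ?H v u * (if u = s then ?e s else 0))"
      using fin s by (simp add: if_distrib cong: if_cong)
    finally show "(\<Sum>u\<in>V n. ?M v u * ?H u s) = (\<Sum>u\<in>V n. ?H v u * (if u = s then ?e s else 0))" .
  qed
  also have "\<dots> = det_on (V n) ?H * det_on (V n) (\<lambda>u s. if u = s then ?e s else 0)"
    by (rule det_on_mult[OF fin])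
  also have "det_on (V n) (\<lambda>u s. if u = s then ?e s else 0) = (\<Prod>s\<in>V n. ?e s)"
    by (subst det_on_rank[OF fin, where rank = "\<lambda>_. 0"]) (auto split: if_splits)
  finally show ?thesis using H by simp
qed

section \<open>Counting by support size and comparison of coefficients\<close>

lemma bij_betw_support: "bij_betw (support n) (verts (cube n)) (Pow {1..n})"
proof (rule bij_betwI[where g = "\<lambda>A. \<lambda>i\<in>{1..n}. if i \<in> A then 1 else 0"])
  show "(\<lambda>i\<in>{1..n}. if i \<in> support n s then 1 else 0) = s" if "s \<in> verts (cube n)" for s
    using cube_val[OF that] cube_undefined[OF that] by (fastforce simp: support_def fun_eq_iff)
qed (auto simp: support_def verts_cube)

text \<open>Group the nonempty subsets by size; there are \<open>2 ^ card A - 1\<close> of them,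
  which is the exponent of \<open>c\<close>.\<close>

lemma prod_card_Pow:
  assumes "finite A"
  shows "(\<Prod>B\<in>Pow A - {{}}. c * card B) = c ^ (2 ^ card A - 1) * (\<Prod>k=1..card A. k ^ (card A choose k))"
proof -
  have "(\<Prod>B\<in>Pow A - {{}}. card B) = (\<Prod>k=1..card A. \<Prod>B | B \<in> Pow A - {{}} \<and> card B = k. card B)"
    using assms
    by (intro prod.group[symmetric]) (auto simp: card_mono card_gt_0_iff Suc_le_eq dest: finite_subset)
  also have "\<dots> = (\<Prod>k=1..card A. k ^ (card A choose k))"
  proof (rule prod.cong[OF refl])
    fix k assume k: "k \<in> {1..card A}"
    then have "{B \<in> Pow A - {{}}. card B = k} = {B. B \<subseteq> A \<and> card B = k}" by auto
    then show "(\<Prod>B | B \<in> Pow A - {{}} \<and> card B = k. card B) = k ^ (card A choose k)"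
      using assms by (simp add: n_subsets)
  qed
  finally show ?thesis
    using assms by (simp add: prod.distrib card_Pow)
qed

theorem proposition4p3:
  fixes n :: nat
  assumes "n \<ge> 1"
  shows "num_spanning_trees (cube n) = 2 ^ (2 ^ n - n - 1) * (\<Prod>k = 1..n. k ^ (n choose k))"
proof -
  let ?V = "verts (cube n)"
  define F where "F = {f \<in> ?V \<rightarrow>\<^sub>E ?V. rooted ?V f \<and> (\<forall>v\<in>?V. f v \<noteq> v \<longrightarrow> adjacent (cube n) v (f v))}"
  define roots where "roots f = card {v \<in> ?V. f v = v}" for f
  have finF: "finite F"
    by (simp add: F_def finite_PiE finite_verts_cube)
  \<comment> \<open>The generating polynomial of rooted forests by number of roots.\<close>
  define p where "p = (\<Sum>f\<in>F. monom (1::real) (roots f))"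
  \<comment> \<open>The product of all X + 2|A| except the factor X of the empty support;
    \<open>pCons 0\<close> restores that factor.\<close>
  define q where "q = (\<Prod>A\<in>Pow {1..n} - {{}}. [:real (2 * card A), 1:])"
  have "poly p t = poly (pCons 0 q) t" for t
  proof -
    have "poly p t = (\<Sum>f\<in>F. t ^ roots f)"
      by (simp add: p_def poly_sum poly_monom)
    also have "\<dots> = (\<Prod>s\<in>?V. t + 2 * card (support n s))"
      unfolding F_def roots_def det_on_laplacian[OF finite_verts_cube, symmetric]
      by (rule det_on_cube_laplacian)
    also have "\<dots> = (\<Prod>A\<in>Pow {1..n}. t + 2 * card A)"
      by (rule prod.reindex_bij_betw[OF bij_betw_support])
    also have "\<dots> = poly (pCons 0 q) t"
      by (subst prod.remove[of _ "{}"]) (auto simp: q_def poly_prod add.commute)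
    finally show ?thesis .
  qed
  \<comment> \<open>Real polynomials that agree at every point are equal, so coefficients may be
    compared.\<close>
  then have pq: "p = pCons 0 q"
    by (simp add: poly_eq_poly_eq_iff[symmetric] fun_eq_iff)
  have "coeff p 1 = real (card {f \<in> F. roots f = 1})"
    using finF by (simp add: p_def coeff_sum flip: sum.inter_filter)
  also have "{f \<in> F. roots f = 1} = {f \<in> ?V \<rightarrow>\<^sub>E ?V. rooted ?V f \<and>
      (\<forall>v\<in>?V. f v \<noteq> v \<longrightarrow> adjacent (cube n) v (f v)) \<and> card {v \<in> ?V. f v = v} = 1}"
    by (auto simp: F_def roots_def)
  finally have "coeff p 1 = real (2 ^ n * num_spanning_trees (cube n))"
    by (simp only: card_rooted_maps[OF finite_verts_cube] card_verts_cube)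
  moreover have "coeff p 1 = poly q 0"
    by (simp add: pq poly_0_coeff_0)
  moreover have "poly q 0 = real (\<Prod>A\<in>Pow {1..n} - {{}}. 2 * card A)"
    by (simp add: q_def poly_prod)
  ultimately have "2 ^ n * num_spanning_trees (cube n) = (\<Prod>A\<in>Pow {1..n} - {{}}. 2 * card A)"
    by (metis of_nat_eq_iff)
  also have "\<dots> = 2 ^ (2 ^ n - 1) * (\<Prod>k=1..n. k ^ (n choose k))"
    by (subst prod_card_Pow) simp_all
  also have "(2::nat) ^ (2 ^ n - 1) = 2 ^ n * 2 ^ (2 ^ n - n - 1)"
  proof -
    \<comment> \<open>\<open>n < 2 ^ n\<close> makes the truncated subtraction exact; the factor
      \<open>2 ^ n\<close>, the number of possible roots, then cancels.\<close>
    have "2 ^ n - 1 = n + (2 ^ n - n - 1)"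
      using less_exp[of n] by linarith
    then show ?thesis by (simp flip: power_add)
  qed
  finally show ?thesis by simp
qed

end
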